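(* Let $n\ge 1$, let $\mathcal Z\subseteq\mathbb R^n$ be the common real zero set of finitely many real polynomials, of dimension $s<n$, and let $S\subseteq \mathcal Z\cap[-1,1]^n$ be nonempty and compact. For each integer $m\ge 1$ let $G_m=\{-1,-1+\tfrac{2}{m},\ldots,1\}^n$ be the uniform grid of $(m+1)^n$ points in $[-1,1]^n$. (i) For every integer $m\ge1$ and every $\hat S\subseteq G_m$, $$d_{\mathrm H}(\hat S,S)\ \ge\ \operatorname{disp}(G_m,S).$$ (ii) Let $\mathcal M\subset \mathcal Z$ be finite, let $\rho\ge 0$ be real, and put $\hat S=\{x\in\mathcal M:\operatorname{dist}(x,S)\le\rho\}$. If $\rho\ge\operatorname{disp}(\mathcal M,S)$, then $d_{\mathrm H}(\hat S,S)\le\rho$. (iii) For $n\ge 1$ let $\mathbf 1=(1,\ldots,1)\in\mathbb R^n$ and let $S_n=\{t\mathbf 1: t\in\mathbb R,\ |t|\le\tfrac12\}\subset\mathbb R^n$, which is the set of minimizers of $\sum_{1\le i<j\le n}(x_i-x_j)^2$ over $[-\tfrac12,\tfrac12]^n$; here the carrier is the line $\mathcal Z=\mathbb R\mathbf 1$. Then $$\operatorname{disp}(G_m,S_n)\ \ge\ \frac{\sqrt n}{m}\qquad\text{for every integer } m\ge1.$$ On the other hand, let $\epsilon\in(0,1)$ and let $N\ge 1$ be an integer with $N\ge4\ln(N/\epsilon)$. If $\mathcal M$ consists of $N$ points drawn independently and uniformly from $\mathcal Z\cap[-1,1]^n$, where $\mathcal Z=\mathbb R\mathbf 1$, and $\hat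 S=\mathcal M\cap S_n$, then with probability at least $1-\epsilon$ $$d_{\mathrm H}(\hat S,S_n)\ \le\ 4\sqrt n\,\frac{\ln(N/\epsilon)}{N}.$$
   Context: $\|\cdot\|$ is the Euclidean norm on $\mathbb R^n$. For $y\in\mathbb R^n$ and $A\subseteq\mathbb R^n$, $\operatorname{dist}(y,A)=\inf_{x\in A}\|x-y\|$ (a minimum when $A$ is nonempty and compact, in particular when it is finite and nonempty), with the convention $\operatorname{dist}(y,\emptyset)=+\infty$. The Hausdorff distance is $$d_{\mathrm H}(A,B)=\max\Big\{\sup_{a\in A}\inf_{b\in B}\|a-b\|,\ \sup_{b\in B}\inf_{a\in A}\|a-b\|\Big\},$$ with the convention $d_{\mathrm H}(\emptyset,S)=+\infty$. Dispersion: for a finite set $G\subset\mathbb R^n$ and a compact set $S\subseteq\mathbb R^n$, $$\operatorname{disp}(G,S):=\sup_{y\in S}\operatorname{dist}(y,G)=\sup_{y\in S}\min_{x\in G}\|x-y\|.$$ A uniform random point of $\mathbb R\mathbf 1\cap[-1,1]^n=\{t\mathbf 1:|t|\le1\}$ means uniform with respect to normalized one-dimensional Hausdorff measure, i.e. the point $t\mathbf 1$ with $t$ uniformly distributed on $[-1,1]$.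
   Formalization: In the sampling clause of (iii), N ≥ 1 is replaced by N ≥ 2: for N = 1 and ε = 9/10 the hypotheses hold, but one point is always at Hausdorff distance at least √n/2 from S_n, exceeding the bound of about 0.42√n. *)

theory Defs
  imports "HOL-Probability.Probability"
begin

text \<open>
  Distances to possibly empty sets take values in \<^typ>\<open>ennreal\<close>: the infimum over the empty set is
  then \<^term>\<open>\<infinity> :: ennreal\<close>, unlike for \<^const>\<open>infdist\<close>, which is 0 on the empty set.
\<close>

definition ext_dist :: "'a::real_normed_vector \<Rightarrow> 'a set \<Rightarrow> ennreal" where
  "ext_dist y A = (INF x\<in>A. ennreal (norm (x - y)))"

text \<open>The value is \<^term>\<open>\<infinity> :: ennreal\<close> as soon as exactly one of the two sets is empty.\<close>

definition hausdorff_dist :: "'a::real_normed_vector set \<Rightarrow> 'a set \<Rightarrow> ennreal" where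
  "hausdorff_dist A B =
     max (SUP a\<in>A. INF b\<in>B. ennreal (norm (a - b)))
         (SUP b\<in>B. INF a\<in>A. ennreal (norm (a - b)))"

definition dispersion :: "'a::real_normed_vector set \<Rightarrow> 'a set \<Rightarrow> ennreal" where
  "dispersion G S = (SUP y\<in>S. ext_dist y G)"

lemma hausdorff_dist_empty: "S \<noteq> {} \<Longrightarrow> hausdorff_dist {} S = \<infinity>"
  by (simp add: hausdorff_dist_def)

text \<open>Over the infinite field of reals, polynomials may be identified with polynomial functions.\<close>

definition real_algebraic_set :: "(real ^ 'n) set \<Rightarrow> bool" where
  "real_algebraic_set Z \<longleftrightarrow>
     (\<exists>F. finite F \<and> (\<forall>p\<in>F. real_polynomial_function p) \<and> Z = {x. \<forall>p\<in>F. p x = 0})"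

definition irreducible_algebraic_set :: "(real ^ 'n) set \<Rightarrow> bool" where
  "irreducible_algebraic_set V \<longleftrightarrow> real_algebraic_set V \<and> V \<noteq> {} \<and>
     (\<forall>A B. real_algebraic_set A \<longrightarrow> real_algebraic_set B \<longrightarrow> V = A \<union> B \<longrightarrow> V = A \<or> V = B)"

text \<open>
  Krull dimension in the Zariski topology: the supremum of the lengths \<open>d\<close> of chains
  \<open>V 0 \<subset> \<dots> \<subset> V d\<close> of irreducible algebraic subsets.
  The empty set gets dimension 0.
\<close>

definition algebraic_dim :: "(real ^ 'n) set \<Rightarrow> enat" where
  "algebraic_dim Z = Sup {enat d | d. \<exists>V :: nat \<Rightarrow> (real ^ 'n) set.
     (\<forall>i\<le>d. irreducible_algebraic_set (V i) \<and> V i \<subseteq> Z) \<and> (\<forall>i<d. V i \<subset> V (Suc i))}"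

text \<open>In the following, \<open>1 :: real ^ 'n\<close> is the all-ones vector, so \<open>cbox (- 1) 1\<close> is the cube.\<close>

definition uniform_grid :: "nat \<Rightarrow> (real ^ 'n) set" where
  "uniform_grid m = {x. \<forall>i. \<exists>k\<le>m. x $ i = - 1 + 2 * real k / real m}"

definition diagonal_line :: "(real ^ 'n) set" where
  "diagonal_line = {t *\<^sub>R 1 | t. True}"

definition diagonal_segment :: "(real ^ 'n) set" where
  "diagonal_segment = {t *\<^sub>R 1 | t. \<bar>t\<bar> \<le> 1 / 2}"

text \<open>
  The index type \<open>'n\<close> carries no order; \<open>e\<close> is an enumeration of the coordinates
  by \<open>{1..CARD('n)}\<close>.
\<close>

definition pairwise_square_sum :: "(nat \<Rightarrow> 'n) \<Rightarrow> real ^ 'n \<Rightarrow> real" where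
  "pairwise_square_sum e x =
     (\<Sum>(i, j) \<in> {(i, j). 1 \<le> i \<and> i < j \<and> j \<le> CARD('n)}. (x $ e i - x $ e j)\<^sup>2)"

text \<open>The law of \<open>t *\<^sub>R 1\<close> for \<open>t\<close> uniform on \<open>[-1, 1]\<close>. A single sample point
  is always at Hausdorff distance at least \<open>sqrt n / 2\<close> from the segment, so the sampling bound
  \<open>4 * sqrt n * ln (N / \<epsilon>) / N\<close> fails for \<open>N = 1\<close> and \<open>\<epsilon>\<close> close to 1.
  It is therefore stated for \<open>N \<ge> 2\<close>.\<close>

definition uniform_on_diagonal :: "(real ^ 'n) measure" where
  "uniform_on_diagonal = distr (uniform_measure lborel {- 1 .. 1}) borel (\<lambda>t. t *\<^sub>R 1)"

lemma diagonal_line_Int_cube: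
  "diagonal_line \<inter> cbox (- 1) 1 = {t *\<^sub>R 1 | t. \<bar>t\<bar> \<le> 1}"
  by (auto simp: diagonal_line_def mem_box_cart abs_le_iff)

end

theory Submission
  imports Defs
begin

text \<open>
  For the sampling bound put \<open>L = ln (N / \<epsilon>)\<close> and \<open>r = 4 * L / N \<le> 1\<close>, and cut the parameter
  interval \<open>[-1/2, 1/2]\<close> into \<open>k = \<lceil>1 / r\<rceil> \<le> 2 / r\<close> pieces of length \<open>1 / k \<le> r\<close>. A fixed piece
  contains no sample point with probability \<open>(1 - 1 / (2 * k)) ^ N \<le> exp (- N * r / 4) = \<epsilon> / N\<close>, and
  \<open>k \<le> N\<close> because \<open>L \<ge> ln 2 \<ge> 1 / 2\<close>; so with probability at least \<open>1 - \<epsilon>\<close> every piece is hit, and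
  then every point of the segment is within \<open>r * sqrt n\<close> of a sample point.
  The dispersion of the grid is bounded from below at a diagonal point halfway between two
  consecutive grid values, which for \<open>m\<close> odd is \<open>0\<close> and for \<open>m\<close> even is \<open>1 / m\<close>.
\<close>

section \<open>Distances to finite sets and the two halves of the Hausdorff distance\<close>

text \<open>A finite nonempty set attains its infimum. For empty \<open>A\<close> both sides are
  false, because the infimum is infinite while \<open>ennreal r\<close> is not.\<close>

lemma ext_dist_le_iff_finite:
  assumes "finite A"
  shows "ext_dist y A \<le> ennreal r \<longleftrightarrow> (\<exists>x\<in>A. ennreal (norm (x - y)) \<le> ennreal r)"
proof (cases "A = {}")
  case False
  with assms have "ext_dist y A = Min ((\<lambda>x. ennreal (norm (x - y))) ` A)"
    unfolding ext_dist_def by (intro cInf_eq_Min) auto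
  then show ?thesis
    using assms False by (simp add: Min_le_iff)
qed (simp add: ext_dist_def top_unique)

text \<open>One half of the Hausdorff distance is exactly the dispersion. Lower bounds can thus be
  read off the dispersion alone, and upper bounds need only the other half in addition.\<close>

lemma hausdorff_dist_eq:
  "hausdorff_dist A B = max (SUP a\<in>A. ext_dist a B) (dispersion A B)"
  by (simp add: hausdorff_dist_def dispersion_def ext_dist_def norm_minus_commute)

lemma dispersion_antimono: "A \<subseteq> B \<Longrightarrow> dispersion B S \<le> dispersion A S"
  unfolding dispersion_def ext_dist_def by (intro SUP_mono' INF_superset_mono) auto

text \<open>A point of \<open>M\<close> within \<open>\<rho>\<close> of some \<open>y\<close> in
  \<open>S\<close> is itself within \<open>\<rho>\<close> of \<open>S\<close>, so the filter keeps
  it and \<open>y\<close> stays covered. The other half of the distance is bounded by the filter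
  condition itself.\<close>

lemma hausdorff_dist_filter_le:
  assumes "finite M" "dispersion M S \<le> ennreal \<rho>"
  shows "hausdorff_dist {x \<in> M. ext_dist x S \<le> ennreal \<rho>} S \<le> ennreal \<rho>" (is "hausdorff_dist ?T S \<le> _")
proof -
  have "ext_dist y ?T \<le> ennreal \<rho>" if "y \<in> S" for y
  proof -
    have "ext_dist y M \<le> ennreal \<rho>"
      using assms(2) that by (simp add: dispersion_def SUP_le_iff)
    then obtain x where x: "x \<in> M" "ennreal (norm (x - y)) \<le> ennreal \<rho>"
      using assms(1) by (auto simp: ext_dist_le_iff_finite)
    have "ext_dist x S \<le> ennreal (norm (x - y))"
      unfolding ext_dist_def using that by (intro INF_lower2[of y]) (auto simp: norm_minus_commute)
    with x have "x \<in> ?T"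
      by auto
    with x(2) assms(1) show ?thesis
      by (subst ext_dist_le_iff_finite) auto
  qed
  then show ?thesis
    by (auto simp: hausdorff_dist_eq dispersion_def SUP_le_iff)
qed

text \<open>Points of \<open>A \<inter> B\<close> have distance 0 to \<open>B\<close>, so only the
  covering of \<open>B\<close> matters. This turns the sampling event into a covering
  condition.\<close>

lemma hausdorff_dist_Int_le_iff:
  assumes "finite A" "0 \<le> r"
  shows "hausdorff_dist (A \<inter> B) B \<le> ennreal r \<longleftrightarrow> (\<forall>y\<in>B. \<exists>x\<in>A \<inter> B. norm (x - y) \<le> r)"
proof -
  have "ext_dist x B \<le> ennreal r" if "x \<in> A \<inter> B" for x
    unfolding ext_dist_def using that by (intro INF_lower2[of x]) auto
  then have "hausdorff_dist (A \<inter> B) B \<le> ennreal r \<longleftrightarrow> (\<forall>y\<in>B. ext_dist y (A \<inter> B) \<le> ennreal r)"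
    by (auto simp: hausdorff_dist_eq dispersion_def SUP_le_iff)
  then show ?thesis
    using assms by (subst (asm) ext_dist_le_iff_finite) auto
qed

section \<open>The diagonal line and the minimizers of the pairwise square sum\<close>

lemma norm_one_vec: "norm (1 :: real ^ 'n) = sqrt (real CARD('n))"
  by (simp add: norm_vec_def L2_set_def)

lemma norm_vec_ge:
  fixes x :: "real ^ 'n"
  assumes "0 \<le> c" "\<And>i. c \<le> \<bar>x $ i\<bar>"
  shows "sqrt (real CARD('n)) * c \<le> norm x"
proof -
  have "sqrt (real CARD('n)) * c = norm (c *\<^sub>R (1 :: real ^ 'n))"
    using assms(1) by (simp add: norm_one_vec)
  also have "\<dots> \<le> norm x"
    using assms by (intro norm_le_componentwise_cart) auto
  finally show ?thesis .
qed

lemma diagonal_line_eq: "diagonal_line = {x :: real ^ 'n. \<forall>i j. x $ i = x $ j}"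
proof (intro set_eqI iffI)
  fix x :: "real ^ 'n"
  assume "x \<in> {x. \<forall>i j. x $ i = x $ j}"
  \<comment> \<open>All coordinates agree, so \<open>undefined\<close> serves as an arbitrary
    index.\<close>
  then have "x = (x $ undefined) *\<^sub>R 1"
    by (auto simp: vec_eq_iff)
  then show "x \<in> diagonal_line"
    unfolding diagonal_line_def by blast
qed (auto simp: diagonal_line_def)

lemma diagonal_segment_eq:
  "diagonal_segment = diagonal_line \<inter> cbox ((- 1 / 2) *\<^sub>R 1) ((1 / 2) *\<^sub>R (1 :: real ^ 'n))"
  by (auto simp: diagonal_line_def diagonal_segment_def mem_box_cart abs_le_iff)

lemma real_algebraic_set_diagonal_line: "real_algebraic_set (diagonal_line :: (real ^ 'n) set)"
  unfolding real_algebraic_set_def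
proof (intro exI conjI ballI)
  let ?F = "(\<lambda>(i, j) (x :: real ^ 'n). x $ i - x $ j) ` UNIV"
  show "finite ?F"
    by simp
  show "real_polynomial_function p" if "p \<in> ?F" for p
    using that
    by (auto intro!: real_polynomial_function.intros(1) bounded_linear_sub bounded_linear_vec_nth)
  show "diagonal_line = {x. \<forall>p\<in>?F. p x = 0}"
    by (auto simp: diagonal_line_eq)
qed

lemma pairwise_square_sum_nonneg: "0 \<le> pairwise_square_sum e x"
  unfolding pairwise_square_sum_def by (intro sum_nonneg) auto

lemma pairwise_square_sum_eq_0_iff:
  fixes x :: "real ^ 'n"
  assumes "bij_betw e {1..CARD('n)} (UNIV :: 'n set)"
  shows "pairwise_square_sum e x = 0 \<longleftrightarrow> x \<in> diagonal_line"
proof -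
  let ?n = "CARD('n)"
  \<comment> \<open>Over an infinite index set \<open>sum\<close> would be 0 by default; finiteness
    allows the vanishing to be read term by term.\<close>
  have "finite {(i, j). 1 \<le> i \<and> i < j \<and> j \<le> ?n}"
    by (rule finite_subset[of _ "{1..?n} \<times> {1..?n}"]) auto
  then have "pairwise_square_sum e x = 0 \<longleftrightarrow>
      (\<forall>i j. 1 \<le> i \<and> i < j \<and> j \<le> ?n \<longrightarrow> x $ e i = x $ e j)"
    unfolding pairwise_square_sum_def by (subst sum_nonneg_eq_0_iff) auto
  also have "\<dots> \<longleftrightarrow> (\<forall>i\<in>{1..?n}. \<forall>j\<in>{1..?n}. x $ e i = x $ e j)"
    by (auto, metis linorder_neqE_nat)
  also have "\<dots> \<longleftrightarrow> (\<forall>i\<in>e ` {1..?n}. \<forall>j\<in>e ` {1..?n}. x $ i = x $ j)"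
    by blast
  finally show ?thesis
    using assms by (simp only: bij_betw_def diagonal_line_eq mem_Collect_eq ball_UNIV)
qed

text \<open>The sum is nonnegative and takes the value 0 at the origin, which lies in the box. The
  minimizers are therefore its zeros in the box, that is, the points of the diagonal there.\<close>

lemma diagonal_segment_arg_min:
  assumes "bij_betw e {1..CARD('n)} (UNIV :: 'n set)"
  shows "(diagonal_segment :: (real ^ 'n) set) =
          {x. is_arg_min (pairwise_square_sum e)
                (\<lambda>y. y \<in> cbox ((- 1 / 2) *\<^sub>R 1) ((1 / 2) *\<^sub>R 1)) x}"
proof -
  let ?f = "pairwise_square_sum e :: real ^ 'n \<Rightarrow> real"
  have "(0 :: real ^ 'n) \<in> cbox ((- 1 / 2) *\<^sub>R 1) ((1 / 2) *\<^sub>R 1)" "(0 :: real ^ 'n) \<in> diagonal_line"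
    by (auto simp: mem_box_cart diagonal_line_eq)
  moreover from this(2) have "?f 0 = 0"
    using pairwise_square_sum_eq_0_iff[OF assms] by blast
  ultimately show ?thesis
    using pairwise_square_sum_nonneg[of e] pairwise_square_sum_eq_0_iff[OF assms]
    unfolding diagonal_segment_eq is_arg_min_def
    by (auto simp: not_less) (metis antisym)+
qed

section \<open>Lower bound for the dispersion of the grid\<close>

lemma dispersion_uniform_grid_ge:
  assumes "m \<ge> 1"
  shows "ennreal (sqrt (real CARD('n)) / real m)
    \<le> dispersion (uniform_grid m) (diagonal_segment :: (real ^ 'n) set)"
proof -
  define t where "t = (if odd m then 0 else 1 / real m)"
  have "\<bar>t\<bar> \<le> 1 / 2"
  proof (cases "odd m")
    case False
    \<comment> \<open>An even positive \<open>m\<close> is at least 2, which keeps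
      \<open>1 / m\<close> inside the segment.\<close>
    then have "m \<ge> 2"
      using assms by presburger
    then show ?thesis
      by (simp add: t_def field_simps)
  qed (simp add: t_def)
  have gap: "1 / real m \<le> \<bar>- 1 + 2 * real k / real m - t\<bar>" for k
  proof -
    \<comment> \<open>In units of \<open>1 / m\<close> the offset from \<open>t\<close> to a grid
      value is the integer \<open>d\<close>. The choice of \<open>t\<close> makes it odd for either
      parity of \<open>m\<close>, hence nonzero.\<close>
    define d :: int where "d = 2 * int k - int m - (if odd m then 0 else 1)"
    have "odd d"
      by (auto simp: d_def)
    then have "\<bar>d\<bar> \<ge> 1"
      by presburger
    then have "1 \<le> \<bar>real_of_int d\<bar>"
      by linarith
    moreover have "- 1 + 2 * real k / real m - t = real_of_int d / real m"
      using assms by (auto simp: t_def d_def field_simps)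
    ultimately show ?thesis
      by (simp add: divide_right_mono)
  qed
  have "ennreal (sqrt (real CARD('n)) / real m) \<le> ext_dist (t *\<^sub>R 1) (uniform_grid m :: (real ^ 'n) set)"
    unfolding ext_dist_def
  proof (intro INF_greatest ennreal_leI)
    fix x :: "real ^ 'n"
    assume "x \<in> uniform_grid m"
    \<comment> \<open>Every coordinate is off by at least \<open>1 / m\<close> simultaneously, which
      yields the factor \<open>sqrt n\<close>.\<close>
    then have "1 / real m \<le> \<bar>(x - t *\<^sub>R 1) $ i\<bar>" for i
      using gap by (auto simp: uniform_grid_def dest!: spec[of _ i])
    then have "sqrt (real CARD('n)) * (1 / real m) \<le> norm (x - t *\<^sub>R 1)"
      by (intro norm_vec_ge) auto
    then show "sqrt (real CARD('n)) / real m \<le> norm (x - t *\<^sub>R 1)"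
      by simp
  qed
  also have "\<dots> \<le> dispersion (uniform_grid m) (diagonal_segment :: (real ^ 'n) set)"
    unfolding dispersion_def diagonal_segment_def using \<open>\<bar>t\<bar> \<le> 1 / 2\<close> by (intro SUP_upper) blast
  finally show ?thesis .
qed

section \<open>The uniform law on the diagonal\<close>

lemma compact_diagonal_piece: "compact ((\<lambda>t. t *\<^sub>R (1 :: real ^ 'n)) ` {a..b})"
  by (intro compact_continuous_image continuous_intros) auto

lemma diagonal_segment_image: "diagonal_segment = (\<lambda>t. t *\<^sub>R 1) ` {- 1 / 2..1 / 2}"
  unfolding diagonal_segment_def abs_le_iff by (auto intro!: image_eqI)

lemma measure_uniform_on_diagonal:
  assumes "A \<in> sets borel"
  shows "measure (uniform_on_diagonal :: (real ^ 'n) measure) A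
    = measure (uniform_measure lborel {- 1..1}) ((\<lambda>t. t *\<^sub>R 1) -` A)"
  unfolding uniform_on_diagonal_def
  using assms by (subst measure_distr) auto

text \<open>Injectivity of the parametrization pulls the piece back to \<open>{a..b}\<close>; the
  divisor 2 is the length of \<open>{- 1..1}\<close>.\<close>

lemma measure_uniform_on_diagonal_piece:
  assumes "- 1 \<le> a" "a \<le> b" "b \<le> 1"
  shows "measure (uniform_on_diagonal :: (real ^ 'n) measure) ((\<lambda>t. t *\<^sub>R 1) ` {a..b}) = (b - a) / 2"
proof -
  have inj: "inj (\<lambda>t. t *\<^sub>R (1 :: real ^ 'n))"
    by (auto intro!: injI)
  have "measure (uniform_on_diagonal :: (real ^ 'n) measure) ((\<lambda>t. t *\<^sub>R 1) ` {a..b})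
    = measure (uniform_measure lborel {- 1..1}) {a..b}"
    using compact_imp_closed[OF compact_diagonal_piece[where 'n = 'n]] inj_vimage_image_eq[OF inj]
    by (subst measure_uniform_on_diagonal) auto
  also have "\<dots> = measure lborel ({- 1..1} \<inter> {a..b}) / measure lborel {- 1..1 :: real}"
    by (subst measure_uniform_measure) auto
  also have "{- 1..1} \<inter> {a..b} = {a..b}"
    using assms by auto
  finally show ?thesis
    using assms by simp
qed

section \<open>Measurability of the covering event\<close>

text \<open>Rational parameters are dense and \<open>C\<close> is closed. This trades an uncountable
  quantifier for a countable one.\<close>

lemma all_diagonal_segment_iff_rat:
  assumes "closed C"
  shows "(\<forall>y\<in>diagonal_segment. (y :: real ^ 'n) \<in> C) \<longleftrightarrow> (\<forall>q\<in>\<rat> \<inter> {- 1 / 2..1 / 2}. q *\<^sub>R 1 \<in> C)"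
proof
  assume *: "\<forall>q\<in>\<rat> \<inter> {- 1 / 2..1 / 2}. q *\<^sub>R 1 \<in> C"
  let ?D = "(\<lambda>t. t *\<^sub>R (1 :: real ^ 'n)) -` C"
  have "closed ?D"
    using assms by (intro closed_vimage continuous_intros)
  \<comment> \<open>The open interval is used because a dense set stays dense in an open set; the
    closure restores the endpoints.\<close>
  moreover have "\<rat> \<inter> {- 1 / 2<..<1 / 2} \<subseteq> ?D"
    using * by auto
  ultimately have "closure (\<rat> \<inter> {- 1 / 2<..<1 / 2}) \<subseteq> ?D"
    by (rule closure_minimal[rotated])
  moreover have "closure (\<rat> \<inter> {- 1 / 2<..<1 / 2}) = {- 1 / 2..1 / 2 :: real}"
  proof -
    have "closure ({- 1 / 2<..<1 / 2} \<inter> \<rat>) = closure {- 1 / 2<..<1 / 2 :: real}"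
      by (intro closure_open_Int_superset) (auto simp: Rats_closure_real)
    then show ?thesis
      by (simp add: Int_commute)
  qed
  ultimately show "\<forall>y\<in>diagonal_segment. y \<in> C"
    by (auto simp: diagonal_segment_image)
qed (auto simp: diagonal_segment_image)

text \<open>For a fixed outcome the covered points form a finite union of closed balls, hence a
  closed set, so testing rational parameters suffices. The event then becomes a countable
  intersection of finite unions of measurable events.\<close>

lemma sets_diagonal_cover_event:
  fixes X :: "nat \<Rightarrow> 'w \<Rightarrow> real ^ 'n"
  assumes "\<And>i. i < N \<Longrightarrow> X i \<in> borel_measurable P"
  shows "{\<omega> \<in> space P. \<forall>y\<in>diagonal_segment.
    \<exists>x\<in>(\<lambda>i. X i \<omega>) ` {..<N} \<inter> diagonal_segment. norm (x - y) \<le> R} \<in> sets P"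
proof -
  have seg: "(diagonal_segment :: (real ^ 'n) set) \<in> sets borel"
    unfolding diagonal_segment_image by (intro borel_closed compact_imp_closed compact_diagonal_piece)
  have rat: "(\<forall>y\<in>diagonal_segment. \<exists>x\<in>F \<inter> diagonal_segment. norm (x - y) \<le> R) \<longleftrightarrow>
      (\<forall>q\<in>\<rat> \<inter> {- 1 / 2..1 / 2}. \<exists>x\<in>F \<inter> diagonal_segment. norm (x - q *\<^sub>R 1) \<le> R)"
    if "finite F" for F :: "(real ^ 'n) set"
  proof -
    have "(\<Union>x\<in>F \<inter> diagonal_segment. cball x R) = {y. \<exists>x\<in>F \<inter> diagonal_segment. norm (x - y) \<le> R}"
      by (auto simp: dist_norm)
    moreover have "closed (\<Union>x\<in>F \<inter> diagonal_segment. cball x R)"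
      using that by (intro closed_UN) auto
    ultimately show ?thesis
      using all_diagonal_segment_iff_rat[of "{y. \<exists>x\<in>F \<inter> diagonal_segment. norm (x - y) \<le> R}"] by simp
  qed
  \<comment> \<open>The sample set depends on \<open>\<omega>\<close>, the index set does not; only
    the latter gives a finite union of events.\<close>
  have index: "(\<exists>x\<in>(\<lambda>i. X i \<omega>) ` {..<N} \<inter> diagonal_segment. norm (x - y) \<le> R) \<longleftrightarrow>
      (\<exists>i\<in>{..<N}. X i \<omega> \<in> diagonal_segment \<and> norm (X i \<omega> - y) \<le> R)" for \<omega> y
    by blast
  have "{\<omega> \<in> space P. \<forall>y\<in>diagonal_segment.
      \<exists>x\<in>(\<lambda>i. X i \<omega>) ` {..<N} \<inter> diagonal_segment. norm (x - y) \<le> R}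
    = {\<omega> \<in> space P. \<forall>q\<in>\<rat> \<inter> {- 1 / 2..1 / 2}. \<exists>i\<in>{..<N}.
        X i \<omega> \<in> diagonal_segment \<and> norm (X i \<omega> - q *\<^sub>R 1) \<le> R}"
  proof (intro Collect_cong conj_cong refl)
    fix \<omega>
    show "(\<forall>y\<in>diagonal_segment. \<exists>x\<in>(\<lambda>i. X i \<omega>) ` {..<N} \<inter> diagonal_segment. norm (x - y) \<le> R) \<longleftrightarrow>
      (\<forall>q\<in>\<rat> \<inter> {- 1 / 2..1 / 2}. \<exists>i\<in>{..<N}. X i \<omega> \<in> diagonal_segment \<and> norm (X i \<omega> - q *\<^sub>R 1) \<le> R)"
      unfolding index[symmetric] by (rule rat) simp
  qed
  also have "\<dots> \<in> sets P"
  proof (intro sets.sets_Collect_countable_All' sets.sets_Collect_finite_Ex sets.sets_Collect_conj)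
    show "{\<omega> \<in> space P. X i \<omega> \<in> diagonal_segment} \<in> sets P" if "i \<in> {..<N}" for i
      using measurable_sets[OF assms seg, of i] that by (simp add: vimage_def Int_def conj_commute)
    show "{\<omega> \<in> space P. norm (X i \<omega> - q *\<^sub>R 1) \<le> R} \<in> sets P" if "i \<in> {..<N}" for i q
    proof -
      have "(\<lambda>\<omega>. norm (X i \<omega> - q *\<^sub>R 1)) \<in> borel_measurable P"
        using assms[of i] that
        by (intro measurable_compose[OF _ borel_measurable_norm] borel_measurable_diff borel_measurable_const) auto
      then show ?thesis
        by (simp add: borel_measurable_iff_le)
    qed
  qed (auto intro: countable_rat countable_subset)
  finally show ?thesis .
qed

section \<open>Partition of the segment and the sampling bound\<close>

lemma interval_partition_covers:
  fixes t :: real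
  assumes "k > 0" "t \<in> {- 1 / 2..1 / 2}"
  obtains j where "j < k" "t \<in> {- 1 / 2 + real j / real k..- 1 / 2 + real (Suc j) / real k}"
proof (cases "t = 1 / 2")
  \<comment> \<open>At the right endpoint the floor used below would give \<open>k\<close>, one too
    many, so the last piece is taken directly.\<close>
  case True
  have "1 / 2 \<in> {- 1 / 2 + real (k - 1) / real k..- 1 / 2 + real (Suc (k - 1)) / real k}"
    using assms(1) by (simp add: of_nat_diff diff_divide_distrib)
  with True show ?thesis
    by (intro that[of "k - 1"]) (use assms(1) in simp, simp only:)
next
  case False
  define u where "u = (t + 1 / 2) * real k"
  define j where "j = nat \<lfloor>u\<rfloor>"
  have u: "0 \<le> u" "u < real k"
    using assms False by (auto simp: u_def)
  then have j: "real j \<le> u" "u \<le> real (Suc j)" "j < k"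
    unfolding j_def by linarith+
  moreover have "t = - 1 / 2 + u / real k"
    using assms by (simp add: u_def)
  ultimately show ?thesis
    using assms that[of j] by (auto simp: divide_right_mono)
qed

lemma (in prob_space) prob_all_miss:
  assumes "indep_vars (\<lambda>_. borel) X {..<N}" "\<And>i. i < N \<Longrightarrow> distr M borel (X i) = D"
    and "J \<in> sets borel" "N > 0"
  shows "prob {\<omega> \<in> space M. \<forall>i<N. X i \<omega> \<notin> J} = (1 - measure D J) ^ N"
proof -
  have X: "random_variable borel (X i)" if "i < N" for i
    using assms(1) that by (auto simp: indep_vars_def)
  have "prob (\<Inter>i\<in>{..<N}. X i -` (- J) \<inter> space M) = (\<Prod>i\<in>{..<N}. prob (X i -` (- J) \<inter> space M))"
    using assms by (intro indep_varsD[OF assms(1)]) (auto simp: lessThan_empty_iff)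
  \<comment> \<open>Here \<open>N > 0\<close> matters: an intersection over no indices would be
    \<open>UNIV\<close> instead of \<open>space M\<close>.\<close>
  also have "(\<Inter>i\<in>{..<N}. X i -` (- J) \<inter> space M) = {\<omega> \<in> space M. \<forall>i<N. X i \<omega> \<notin> J}"
    using assms(4) by auto
  also have "prob (X i -` (- J) \<inter> space M) = 1 - measure D J" if "i < N" for i
  proof -
    have "prob (X i -` (- J) \<inter> space M) = prob (space M - X i -` J \<inter> space M)"
      by (rule arg_cong[where f = prob]) auto
    also have "\<dots> = 1 - prob (X i -` J \<inter> space M)"
      using measurable_sets[OF X[OF that] assms(3)] by (intro prob_compl)
    also have "prob (X i -` J \<inter> space M) = measure D J"
      using measure_distr[OF X[OF that], of J] assms(2)[OF that] assms(3) by simp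
    finally show ?thesis .
  qed
  then have "(\<Prod>i\<in>{..<N}. prob (X i -` (- J) \<inter> space M)) = (1 - measure D J) ^ N"
    by simp
  finally show ?thesis .
qed

text \<open>The numerical side of the union bound: \<open>k\<close> pieces, each of probability
  \<open>1 / (2 * k)\<close> and each missed by \<open>N\<close> independent points.\<close>

lemma sampling_failure_bound:
  fixes \<epsilon> r :: real
  assumes "0 < \<epsilon>" "\<epsilon> < 1" "N \<ge> 2" "4 * ln (real N / \<epsilon>) \<le> real N"
    and r: "r = 4 * ln (real N / \<epsilon>) / real N"
  obtains k :: nat where "k > 0" "1 / real k \<le> r" "real k * (1 - 1 / real (2 * k)) ^ N \<le> \<epsilon>"
proof
  define k where "k = nat \<lceil>1 / r\<rceil>"
  have "1 / 2 \<le> ln (2 :: real)"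
    using ln2_ge_two_thirds by linarith
  \<comment> \<open>This is where \<open>N \<ge> 2\<close> enters: together with
    \<open>\<epsilon> < 1\<close> it gives \<open>N / \<epsilon> \<ge> 2\<close>.\<close>
  also have "\<dots> \<le> ln (real N / \<epsilon>)"
    using assms by (subst ln_le_cancel_iff) (auto simp: field_simps)
  finally have L: "1 / 2 \<le> ln (real N / \<epsilon>)" .
  then have r01: "0 < r" "r \<le> 1"
    using assms by (auto simp: divide_le_eq)
  then have k: "1 / r \<le> real k" "real k \<le> 1 / r + 1"
    unfolding k_def using r01(1) by (auto simp: real_nat_ceiling_ge intro: order_trans[OF _ of_int_ceiling_le_add_one])
  \<comment> \<open>Since \<open>1 \<le> 1 / r\<close>, rounding up at most doubles
    \<open>1 / r\<close>.\<close>
  moreover have "1 \<le> 1 / r"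
    using r01 by simp
  ultimately have k2: "real k \<le> 2 / r" "1 \<le> real k"
    by auto
  then show "k > 0"
    by simp
  then show "1 / real k \<le> r"
    using k r01 by (simp add: field_simps)
  have "real k \<le> real N"
  proof -
    have "2 / r = real N / (2 * ln (real N / \<epsilon>))"
      unfolding r by simp
    also have "\<dots> \<le> real N / 1"
      using L by (intro divide_left_mono) auto
    finally show ?thesis
      using k2 by simp
  qed
  have "(1 - 1 / real (2 * k)) ^ N \<le> exp (- (1 / real (2 * k))) ^ N"
    using k2 exp_ge_add_one_self[of "- (1 / real (2 * k))"] by (intro power_mono) (auto simp: field_simps)
  also have "\<dots> = exp (- (real N / real (2 * k)))"
    by (simp flip: exp_of_nat_mult)
  also have "\<dots> \<le> exp (- ln (real N / \<epsilon>))"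
  proof -
    have "ln (real N / \<epsilon>) = real N * r / 4"
      using assms by simp
    \<comment> \<open>This is \<open>k \<le> 2 / r\<close> rearranged; the constant 4 in
      \<open>r\<close> is this 2 times the 2 from the piece probability
      \<open>1 / (2 * k)\<close>.\<close>
    also have "\<dots> \<le> real N / real (2 * k)"
      using k2 r01 assms by (simp add: field_simps)
    finally show ?thesis
      by simp
  qed
  also have "\<dots> = \<epsilon> / real N"
    using assms by (simp add: exp_minus)
  finally have "real k * (1 - 1 / real (2 * k)) ^ N \<le> real N * (\<epsilon> / real N)"
    using \<open>real k \<le> real N\<close> assms k2 by (intro mult_mono) (auto simp: field_simps)
  then show "real k * (1 - 1 / real (2 * k)) ^ N \<le> \<epsilon>"
    using assms by simp
qed

text \<open>A union bound over the pieces that receive no sample point; outside these events the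
  whole segment is covered within \<open>R\<close>.\<close>

lemma (in prob_space) prob_diagonal_sample_ge:
  fixes X :: "nat \<Rightarrow> 'a \<Rightarrow> real ^ 'n"
  assumes "0 < \<epsilon>" "\<epsilon> < 1" "N \<ge> 2" "4 * ln (real N / \<epsilon>) \<le> real N"
    and ind: "indep_vars (\<lambda>_. borel) X {..<N}"
    and X: "\<And>i. i < N \<Longrightarrow> distr M borel (X i) = uniform_on_diagonal"
  shows "1 - \<epsilon> \<le> prob {\<omega> \<in> space M.
    hausdorff_dist ((\<lambda>i. X i \<omega>) ` {..<N} \<inter> diagonal_segment) diagonal_segment
      \<le> ennreal (4 * sqrt (real CARD('n)) * (ln (real N / \<epsilon>) / real N))}"
proof -
  define r where "r = 4 * ln (real N / \<epsilon>) / real N"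
  obtain k where k: "k > 0" "1 / real k \<le> r" "real k * (1 - 1 / real (2 * k)) ^ N \<le> \<epsilon>"
    using sampling_failure_bound[OF assms(1-4) r_def] by blast
  define R where "R = 4 * sqrt (real CARD('n)) * (ln (real N / \<epsilon>) / real N)"
  have R: "R = r * sqrt (real CARD('n))"
    by (simp add: R_def r_def)
  have "r \<ge> 0"
    using k by (meson divide_nonneg_nonneg of_nat_0_le_iff order_trans zero_le_one)
  then have "R \<ge> 0"
    by (simp add: R)
  define I where "I j = {- 1 / 2 + real j / real k..- 1 / 2 + real (Suc j) / real k}" for j
  define J where "J j = (\<lambda>t. t *\<^sub>R (1 :: real ^ 'n)) ` I j" for j
  define E where "E = {\<omega> \<in> space M. \<forall>y\<in>diagonal_segment.
    \<exists>x\<in>(\<lambda>i. X i \<omega>) ` {..<N} \<inter> diagonal_segment. norm (x - y) \<le> R}"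
  \<comment> \<open>\<open>B j\<close> is the bad event that piece \<open>J j\<close> is missed;
    \<open>E\<close> is the covering event equivalent to the Hausdorff bound.\<close>
  define B where "B j = {\<omega> \<in> space M. \<forall>i<N. X i \<omega> \<notin> J j}" for j
  have rv: "random_variable borel (X i)" if "i < N" for i
    using ind that by (auto simp: indep_vars_def)
  have E: "E \<in> events"
    unfolding E_def using rv by (rule sets_diagonal_cover_event)
  have J: "J j \<in> sets borel" for j
    unfolding J_def I_def by (intro borel_closed compact_imp_closed compact_diagonal_piece)
  have I: "I j \<subseteq> {- 1 / 2..1 / 2}" if "j < k" for j
  proof -
    have "real (Suc j) / real k \<le> 1"
      using that by (simp add: divide_le_eq)
    moreover have "0 \<le> real j / real k"
      by simp
    ultimately show ?thesis
      unfolding I_def by (subst atLeastatMost_subset_iff) linarith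
  qed
  have B_events: "B j \<in> events" for j
  proof -
    have "B j = space M - (\<Union>i\<in>{..<N}. X i -` J j \<inter> space M)"
      by (auto simp: B_def)
    moreover have "(\<Union>i\<in>{..<N}. X i -` J j \<inter> space M) \<in> events"
      using measurable_sets[OF rv J] by (intro sets.finite_UN) auto
    ultimately show ?thesis
      by (simp only: sets.compl_sets)
  qed
  have B_prob: "prob (B j) = (1 - 1 / real (2 * k)) ^ N" if "j < k" for j
  proof -
    have "measure uniform_on_diagonal (J j) = ((- 1 / 2 + real (Suc j) / real k) - (- 1 / 2 + real j / real k)) / 2"
    proof -
      have "real (Suc j) / real k \<le> 1"
        using that by (simp add: divide_le_eq)
      then have "- 1 / 2 + real (Suc j) / real k \<le> 1"
        by simp
      moreover have "- 1 \<le> - 1 / 2 + real j / real k"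
        using divide_nonneg_nonneg[of "real j" "real k"] by linarith
      ultimately show ?thesis
        unfolding J_def I_def
        by (intro measure_uniform_on_diagonal_piece) (auto simp: divide_right_mono)
    qed
    also have "\<dots> = 1 / real (2 * k)"
      using k(1) by (simp add: field_simps)
    finally show ?thesis
      unfolding B_def using assms(3) by (subst prob_all_miss[OF ind X J]) auto
  qed
  have "space M - (\<Union>j<k. B j) \<subseteq> E"
  proof
    fix \<omega>
    assume \<omega>: "\<omega> \<in> space M - (\<Union>j<k. B j)"
    have "\<exists>x\<in>(\<lambda>i. X i \<omega>) ` {..<N} \<inter> diagonal_segment. norm (x - y) \<le> R"
      if y: "y \<in> diagonal_segment" for y
    proof -
      obtain t where t: "t \<in> {- 1 / 2..1 / 2}" "y = t *\<^sub>R 1"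
        using y by (auto simp: diagonal_segment_image)
      obtain j where j: "j < k" "t \<in> I j"
        using interval_partition_covers[OF k(1) t(1)] unfolding I_def by blast
      obtain i where i: "i < N" "X i \<omega> \<in> J j"
        using \<omega> j(1) by (auto simp: B_def)
      then obtain s where s: "s \<in> I j" "X i \<omega> = s *\<^sub>R 1"
        by (auto simp: J_def)
      \<comment> \<open>The sample point and \<open>y\<close> lie in the same piece, so their
        parameters differ by at most its length.\<close>
      have "\<bar>s - t\<bar> \<le> 1 / real k"
        using s(1) j(2) by (auto simp: I_def abs_le_iff add_divide_distrib)
      then have "\<bar>s - t\<bar> \<le> r"
        using k(2) by linarith
      then have "norm (X i \<omega> - y) \<le> R"
        unfolding s(2) t(2) R by (simp add: norm_one_vec mult_right_mono flip: scaleR_diff_left)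
      \<comment> \<open>The pieces with \<open>j < k\<close> lie inside the segment, so the sample
        point survives the intersection with it.\<close>
      moreover have "X i \<omega> \<in> diagonal_segment"
        using s I[OF j(1)] by (auto simp: diagonal_segment_image)
      ultimately show ?thesis
        using i(1) by auto
    qed
    then show "\<omega> \<in> E"
      using \<omega> by (auto simp: E_def)
  qed
  then have "prob (space M - (\<Union>j<k. B j)) \<le> prob E"
    using E by (rule finite_measure_mono)
  moreover have "prob (space M - (\<Union>j<k. B j)) = 1 - prob (\<Union>j<k. B j)"
    using B_events by (intro prob_compl) auto
  moreover have "prob (\<Union>j<k. B j) \<le> (\<Sum>j<k. prob (B j))"
    using B_events by (intro finite_measure_subadditive_finite) auto
  moreover have "(\<Sum>j<k. prob (B j)) \<le> \<epsilon>"
    using k(3) by (simp add: B_prob)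
  ultimately have "1 - \<epsilon> \<le> prob E"
    by linarith
  then show ?thesis
    using \<open>R \<ge> 0\<close> unfolding E_def R_def[symmetric] by (simp add: hausdorff_dist_Int_le_iff)
qed

section \<open>Assembly of the claims\<close>

theorem theorem1:
  shows
    "(\<forall>(Z :: (real ^ 'n) set) s S.
        real_algebraic_set Z \<longrightarrow> algebraic_dim Z = enat s \<longrightarrow> s < CARD('n) \<longrightarrow>
        S \<subseteq> Z \<inter> cbox (- 1) 1 \<longrightarrow> S \<noteq> {} \<longrightarrow> compact S \<longrightarrow>
        (\<forall>m\<ge>1. \<forall>S'. S' \<subseteq> uniform_grid m \<longrightarrow>
           hausdorff_dist S' S \<ge> dispersion (uniform_grid m) S) \<and>
        (\<forall>M (\<rho> :: real) S'. finite M \<longrightarrow> M \<subseteq> Z \<longrightarrow> \<rho> \<ge> 0 \<longrightarrow>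
           S' = {x \<in> M. ext_dist x S \<le> ennreal \<rho>} \<longrightarrow>
           ennreal \<rho> \<ge> dispersion M S \<longrightarrow> hausdorff_dist S' S \<le> ennreal \<rho>)) \<and>
     real_algebraic_set (diagonal_line :: (real ^ 'n) set) \<and>
     (\<forall>e :: nat \<Rightarrow> 'n. bij_betw e {1..CARD('n)} UNIV \<longrightarrow>
        (diagonal_segment :: (real ^ 'n) set) =
          {x. is_arg_min (pairwise_square_sum e)
                (\<lambda>y. y \<in> cbox ((- 1 / 2) *\<^sub>R 1) ((1 / 2) *\<^sub>R 1)) x}) \<and>
     (\<forall>m\<ge>1. dispersion (uniform_grid m) (diagonal_segment :: (real ^ 'n) set)
               \<ge> ennreal (sqrt (real CARD('n)) / real m)) \<and>
     (\<forall>(\<epsilon> :: real) (N :: nat) (P :: 'w measure) (X :: nat \<Rightarrow> 'w \<Rightarrow> real ^ 'n).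
        0 < \<epsilon> \<longrightarrow> \<epsilon> < 1 \<longrightarrow> N \<ge> 2 \<longrightarrow> real N \<ge> 4 * ln (real N / \<epsilon>) \<longrightarrow>
        prob_space P \<longrightarrow> prob_space.indep_vars P (\<lambda>_. borel) X {..<N} \<longrightarrow>
        (\<forall>i<N. distr P borel (X i) = uniform_on_diagonal) \<longrightarrow>
        measure P {\<omega> \<in> space P.
            hausdorff_dist ((\<lambda>i. X i \<omega>) ` {..<N} \<inter> diagonal_segment) diagonal_segment
              \<le> ennreal (4 * sqrt (real CARD('n)) * (ln (real N / \<epsilon>) / real N))}
          \<ge> 1 - \<epsilon>)"
proof (intro conjI allI impI)
  fix S S' :: "(real ^ 'n) set" and m
  assume "S' \<subseteq> uniform_grid m"
  \<comment> \<open>Passing from the grid to its subset \<open>S'\<close> can only raise the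
    dispersion, which is one half of the Hausdorff distance.\<close>
  then show "dispersion (uniform_grid m) S \<le> hausdorff_dist S' S"
    by (simp add: hausdorff_dist_eq dispersion_antimono le_max_iff_disj)
next
  fix S M S' :: "(real ^ 'n) set" and \<rho> :: real
  assume "finite M" "dispersion M S \<le> ennreal \<rho>" "S' = {x \<in> M. ext_dist x S \<le> ennreal \<rho>}"
  then show "hausdorff_dist S' S \<le> ennreal \<rho>"
    using hausdorff_dist_filter_le by blast
next
  fix \<epsilon> :: real and N and P :: "'w measure" and X :: "nat \<Rightarrow> 'w \<Rightarrow> real ^ 'n"
  assume "0 < \<epsilon>" "\<epsilon> < 1" "N \<ge> 2" "real N \<ge> 4 * ln (real N / \<epsilon>)" "prob_space P"
    "prob_space.indep_vars P (\<lambda>_. borel) X {..<N}" "\<forall>i<N. distr P borel (X i) = uniform_on_diagonal"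
  then show "measure P {\<omega> \<in> space P.
      hausdorff_dist ((\<lambda>i. X i \<omega>) ` {..<N} \<inter> diagonal_segment) diagonal_segment
        \<le> ennreal (4 * sqrt (real CARD('n)) * (ln (real N / \<epsilon>) / real N))} \<ge> 1 - \<epsilon>"
    by (intro prob_space.prob_diagonal_sample_ge) auto
qed (fact real_algebraic_set_diagonal_line diagonal_segment_arg_min dispersion_uniform_grid_ge)+

end
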